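(* Let $L$ be a lattice, let $n\ge 1$, let $a_1,\dots,a_n\in L\setminus\{1\}$ be pairwise comaximal elements and set $a=a_1a_2\cdots a_n$. Then every $b\in L$ with $\sqrt{b}=\sqrt{a}$ can be uniquely written as a product $b=b_1\cdots b_n$ of pairwise comaximal elements $b_1,\dots,b_n\in L$ such that $\sqrt{b_i}=\sqrt{a_i}$ for $i=1,\dots,n$. In particular, if $a$ is a radical element (i.e. $a=\sqrt{a}$), then $a_1,\dots,a_n$ are radical elements.
   Context: A multiplicative lattice is an ordered commutative monoid $(L,\le,\cdot)$ such that $(L,\le)$ is a complete lattice with top element $1$ and bottom element $0$, $0\ne 1$; $x(\bigvee Y)=\bigvee_{y\in Y}xy$ for all $x\in L$, $Y\subseteq L$; and $x1=x$ for all $x\in L$. An element $c\in L$ is compact if $c\le\bigvee H$ with $H\subseteq L$ implies $c\le\bigvee F$ for some finite $F\subseteq H$. A subset $G\subseteq L$ generates $L$ if every element of $L$ is the join of some subset of $G$. Throughout, "lattice" means a multiplicative lattice $L$ such that (i) $1$ is compact, (ii) $L$ is generated by the set of its compact elements, (iii) every product of two compact elements is compact. The radical of $a\in L$ is $\sqrt{a}=\bigvee\{x\in L : x^n\le a \text{ for some } n\ge 1\}$. Elements $a,b\in L$ are comaximal if $a\vee b=1$. *)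

theory Defs
  imports "HOL-Library.FuncSet"
begin

class multiplicative_lattice = complete_lattice + comm_monoid_mult +
  assumes mult_le_mono: "x \<le> y \<Longrightarrow> z * x \<le> z * y"
    and one_eq_top: "1 = top"
    and bot_neq_top: "bot \<noteq> top"
    and mult_Sup_distrib: "x * Sup Y = Sup ((\<lambda>y. x * y) ` Y)"

text \<open>Order-theoretic compactness, with respect to arbitrary (not only directed) joins;
  not to be confused with the topological constant \<open>compact\<close>.\<close>

definition (in complete_lattice) compact_element :: "'a \<Rightarrow> bool" where
  "compact_element c \<longleftrightarrow> (\<forall>H. c \<le> Sup H \<longrightarrow> (\<exists>F. finite F \<and> F \<subseteq> H \<and> c \<le> Sup F))"

definition (in complete_lattice) generates :: "'a set \<Rightarrow> bool" where
  "generates G \<longleftrightarrow> (\<forall>x. \<exists>S. S \<subseteq> G \<and> x = Sup S)"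

class compactly_generated_multiplicative_lattice = multiplicative_lattice +
  assumes compact_one: "compact_element 1"
    and generates_compact: "generates {c. compact_element c}"
    and compact_mult: "compact_element c \<Longrightarrow> compact_element d \<Longrightarrow> compact_element (c * d)"

definition radical :: "'a::multiplicative_lattice \<Rightarrow> 'a" where
  "radical a = Sup {x. \<exists>n\<ge>1. x ^ n \<le> a}"

definition comaximal :: "'a::multiplicative_lattice \<Rightarrow> 'a \<Rightarrow> bool" where
  "comaximal a b \<longleftrightarrow> sup a b = 1"

end

theory Submission
  imports Defs
begin

text \<open>
  Two elements whose radicals are comaximal are themselves comaximal (\<open>comaximal_of_radical\<close>):
  since \<open>1\<close> is compact, already a compact part \<open>c \<le> radical x\<close> is comaximal to \<open>y\<close>, a power of
  \<open>c\<close> lies below \<open>x\<close>, and powers of comaximal elements stay comaximal. Hence any factors with the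
  same radicals as the \<open>a\<^sub>i\<close> are automatically pairwise comaximal.

  The existence of the factorization reduces, by induction on the number of factors, to two
  comaximal elements \<open>p\<close>, \<open>q\<close> (\<open>radical_split\<close>). Pick compact \<open>c \<le> p\<close> and \<open>d \<le> q\<close> that are
  still comaximal. Then \<open>c * d\<close> is compact and below \<open>radical b\<close>, so \<open>c ^ k * d ^ k \<le> b\<close> for some
  \<open>k\<close>, and \<open>b\<close> is the product of the comaximal elements \<open>sup b (c ^ k)\<close> and \<open>sup b (d ^ k)\<close>.

  Uniqueness and the statement on radical elements both come from cancelling a comaximal
  factor (\<open>le_of_mult_le_comaximal\<close>): if \<open>x * d \<le> y\<close> with \<open>y\<close>, \<open>d\<close> comaximal, then \<open>x \<le> y\<close>.
  The role of \<open>d\<close> is played by the product of all factors but one.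
\<close>

section \<open>Order properties of the multiplication\<close>

lemma mult_mono_lattice:
  fixes x y z w :: "'a::multiplicative_lattice"
  assumes "x \<le> y" "z \<le> w"
  shows "x * z \<le> y * w"
proof -
  have "x * z \<le> x * w" using assms(2) by (rule mult_le_mono)
  also have "\<dots> \<le> y * w" using mult_le_mono[OF assms(1), of w] by (simp add: mult.commute)
  finally show ?thesis .
qed

lemma le_one_lattice: "(x::'a::multiplicative_lattice) \<le> 1"
  by (simp add: one_eq_top)

lemma mult_le_left: "(x::'a::multiplicative_lattice) * y \<le> x"
  using mult_le_mono[OF le_one_lattice, of x y] by simp

lemma mult_le_right: "(x::'a::multiplicative_lattice) * y \<le> y"
  using mult_le_left[of y x] by (simp add: mult.commute)

lemma mult_sup_distrib:
  fixes x y z :: "'a::multiplicative_lattice"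
  shows "x * sup y z = sup (x * y) (x * z)"
  using mult_Sup_distrib[of x "{y, z}"] by simp

lemma power_mono_lattice:
  fixes x y :: "'a::multiplicative_lattice"
  shows "x \<le> y \<Longrightarrow> x ^ n \<le> y ^ n"
  by (induction n) (auto intro: mult_mono_lattice)

lemma power_le_self:
  fixes x :: "'a::multiplicative_lattice"
  shows "n \<ge> 1 \<Longrightarrow> x ^ n \<le> x"
  by (cases n) (auto intro: mult_le_left)

text \<open>Takes the place of the binomial theorem: in each product of \<open>m + n\<close> factors \<open>x\<close> or \<open>y\<close>,
  either \<open>x\<close> occurs at least \<open>m\<close> times or \<open>y\<close> at least \<open>n\<close> times.\<close>

lemma sup_power_le:
  fixes x y :: "'a::multiplicative_lattice"
  shows "sup x y ^ (m + n) \<le> sup (x ^ m) (y ^ n)"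
proof (induction "m + n" arbitrary: m n)
  case 0
  then show ?case by simp
next
  case (Suc k)
  show ?case
  proof (cases "m = 0 \<or> n = 0")
    case True
    then show ?thesis by (auto simp: one_eq_top)
  next
    case False
    then obtain m' n' where mn: "m = Suc m'" "n = Suc n'"
      by (meson not0_implies_Suc)
    have "x * sup x y ^ k \<le> x * sup (x ^ m') (y ^ n)"
      using Suc(1)[of m' n] Suc(2) mn by (intro mult_le_mono) simp
    also have "\<dots> \<le> sup (x ^ m) (y ^ n)"
      by (auto simp: mult_sup_distrib mn(1) intro: le_supI2 mult_le_right)
    finally have 1: "x * sup x y ^ k \<le> sup (x ^ m) (y ^ n)" .
    have "y * sup x y ^ k \<le> y * sup (x ^ m) (y ^ n')"
      using Suc(1)[of m n'] Suc(2) mn by (intro mult_le_mono) simp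
    also have "\<dots> \<le> sup (x ^ m) (y ^ n)"
      by (auto simp: mult_sup_distrib mn(2) intro: le_supI1 mult_le_right)
    finally have 2: "y * sup x y ^ k \<le> sup (x ^ m) (y ^ n)" .
    have "sup x y ^ (m + n) = sup (x * sup x y ^ k) (y * sup x y ^ k)"
      by (simp add: Suc(2)[symmetric] mult_sup_distrib mult.commute[of _ "sup x y ^ k"])
    then show ?thesis using 1 2 by simp
  qed
qed

section \<open>Comaximal elements\<close>

lemma comaximal_iff_one_le: "comaximal x y \<longleftrightarrow> 1 \<le> sup x y"
  by (simp add: comaximal_def one_eq_top top_unique)

lemma comaximal_commute: "comaximal x y \<longleftrightarrow> comaximal y x"
  by (simp add: comaximal_def sup_commute)

lemma comaximal_mono:
  assumes "comaximal x y" "x \<le> x'" "y \<le> y'"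
  shows "comaximal x' y'"
  using sup_mono[OF assms(2,3)] assms(1) by (simp only: comaximal_iff_one_le order_trans)

lemma comaximal_power:
  assumes "comaximal x y"
  shows "comaximal (x ^ m) (y ^ n)"
  unfolding comaximal_iff_one_le
  using sup_power_le[of x y m n] assms by (simp add: comaximal_def)

text \<open>Cancellation of a comaximal factor: \<open>x = x * sup y d \<le> sup y (x * d) = y\<close>.\<close>

lemma le_of_mult_le_comaximal:
  assumes "comaximal y d" "x * d \<le> y"
  shows "x \<le> y"
proof -
  have "x = x * sup y d" using assms(1) by (simp add: comaximal_def)
  also have "\<dots> \<le> y" using assms(2) by (simp add: mult_sup_distrib mult_le_right)
  finally show ?thesis .
qed

lemma comaximal_mult:
  assumes "comaximal x y" "comaximal x z"
  shows "comaximal x (y * z)"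
proof -
  have "y * z \<le> sup x (y * z)" by simp
  then have "y \<le> sup x (y * z)"
    using comaximal_mono[OF assms(2) sup_ge1 order_refl] by (rule le_of_mult_le_comaximal[rotated])
  then show ?thesis
    using comaximal_mono[OF assms(1) order_refl, of "sup x (y * z)"] by (simp add: comaximal_def)
qed

lemma comaximal_prod:
  assumes "finite J" "\<And>j. j \<in> J \<Longrightarrow> comaximal x (f j)"
  shows "comaximal x (prod f J)"
  using assms
  by (induction J rule: finite_induct) (simp_all add: comaximal_mult comaximal_iff_one_le[of x 1])

lemma comaximal_prod_remove:
  assumes "finite I" "pairwise (\<lambda>i j. comaximal (f i) (f j)) I" "i \<in> I"
  shows "comaximal (f i) (prod f (I - {i}))"
  using assms by (intro comaximal_prod) (auto simp: pairwise_def)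

section \<open>Compact elements and radicals\<close>

lemma le_if_compact_le:
  fixes x y :: "'a::compactly_generated_multiplicative_lattice"
  assumes "\<And>c. compact_element c \<Longrightarrow> c \<le> x \<Longrightarrow> c \<le> y"
  shows "x \<le> y"
proof -
  obtain S where S: "S \<subseteq> {c. compact_element c}" "x = Sup S"
    using generates_compact by (auto simp: generates_def)
  then show ?thesis using assms by (auto intro!: Sup_least Sup_upper)
qed

lemma compact_power:
  fixes c :: "'a::compactly_generated_multiplicative_lattice"
  shows "compact_element c \<Longrightarrow> compact_element (c ^ n)"
  by (induction n) (auto intro: compact_one compact_mult)

lemma compact_sup:
  fixes c d :: "'a::complete_lattice"
  assumes "compact_element c" "compact_element d"
  shows "compact_element (sup c d)"
  unfolding compact_element_def
proof (intro allI impI)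
  fix H :: "'a set" assume "sup c d \<le> Sup H"
  then obtain F G where "finite F" "F \<subseteq> H" "c \<le> Sup F" "finite G" "G \<subseteq> H" "d \<le> Sup G"
    using assms unfolding compact_element_def by (meson le_sup_iff)
  then show "\<exists>F. finite F \<and> F \<subseteq> H \<and> sup c d \<le> Sup F"
    by (intro exI[of _ "F \<union> G"]) (auto simp: Sup_union_distrib intro: le_supI1 le_supI2)
qed

lemma compact_Sup_finite:
  fixes F :: "'a::complete_lattice set"
  assumes "finite F" "\<And>c. c \<in> F \<Longrightarrow> compact_element c"
  shows "compact_element (Sup F)"
  using assms
proof (induction F rule: finite_induct)
  case empty
  show ?case by (auto simp: compact_element_def intro!: exI[of _ "{}"])
next
  case (insert c F)
  then show ?case by (simp add: compact_sup)
qed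

text \<open>Compactness of \<open>1\<close> selects finitely many of the compact elements with join \<open>x\<close> that,
  together with \<open>y\<close>, still have join \<open>1\<close>; their own join is again compact.\<close>

lemma comaximal_compact:
  fixes x y :: "'a::compactly_generated_multiplicative_lattice"
  assumes "comaximal x y"
  obtains c where "compact_element c" "c \<le> x" "comaximal c y"
proof -
  obtain S where S: "S \<subseteq> {c. compact_element c}" "x = Sup S"
    using generates_compact by (auto simp: generates_def)
  have "1 \<le> Sup (insert y S)"
    using assms S by (simp add: comaximal_def sup_commute)
  then obtain F where F: "finite F" "F \<subseteq> insert y S" "1 \<le> Sup F"
    using compact_one unfolding compact_element_def by blast
  let ?c = "Sup (F - {y})"
  have "Sup F \<le> sup ?c y"
    by (rule Sup_least) (metis DiffI Sup_upper empty_iff insert_iff le_supI1 sup_ge2)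
  then have "comaximal ?c y"
    using F(3) by (simp add: comaximal_def one_eq_top top_unique)
  moreover have "compact_element ?c" using F S by (intro compact_Sup_finite) auto
  moreover have "?c \<le> x" using F S by (auto intro: Sup_subset_mono)
  ultimately show thesis using that by blast
qed

lemma self_le_radical: "x \<le> radical x"
  unfolding radical_def by (rule Sup_upper) (auto intro: exI[of _ 1])

lemma le_radical_of_power_le: "n \<ge> 1 \<Longrightarrow> x ^ n \<le> a \<Longrightarrow> x \<le> radical a"
  unfolding radical_def by (rule Sup_upper) auto

lemma power_Sup_finite_le:
  fixes a :: "'a::multiplicative_lattice"
  assumes "finite F" "\<And>x. x \<in> F \<Longrightarrow> \<exists>n\<ge>1. x ^ n \<le> a"
  shows "\<exists>n\<ge>1. Sup F ^ n \<le> a"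
  using assms
proof (induction F rule: finite_induct)
  case empty
  show ?case by (auto intro!: exI[of _ 1])
next
  case (insert x F)
  then obtain m n where mn: "m \<ge> 1" "x ^ m \<le> a" "n \<ge> 1" "Sup F ^ n \<le> a"
    by (meson insertCI)
  have "sup x (Sup F) ^ (m + n) \<le> sup (x ^ m) (Sup F ^ n)" by (rule sup_power_le)
  also have "\<dots> \<le> a" using mn by simp
  finally show ?case using mn by (auto intro!: exI[of _ "m + n"])
qed

text \<open>The defining join of the radical may be infinite, so that no single power of
  \<open>radical a\<close> need lie below \<open>a\<close>; for a compact element finitely many joinands suffice.\<close>

lemma compact_le_radical:
  fixes a :: "'a::multiplicative_lattice"
  assumes "compact_element c" "c \<le> radical a"
  obtains n where "n \<ge> 1" "c ^ n \<le> a"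
proof -
  obtain F where F: "finite F" "F \<subseteq> {x. \<exists>n\<ge>1. x ^ n \<le> a}" "c \<le> Sup F"
    using assms unfolding compact_element_def radical_def by blast
  then obtain n where n: "n \<ge> 1" "Sup F ^ n \<le> a"
    using power_Sup_finite_le[of F a] by auto
  have "c ^ n \<le> a" using power_mono_lattice[OF F(3)] n(2) by (rule order_trans)
  with n(1) show thesis by (rule that)
qed

text \<open>As powers of compact elements are compact, passing to a power below \<open>x\<close> and from there to
  a power below \<open>y\<close> is possible although \<open>x\<close> itself need not be compact.\<close>

lemma radical_le_radical:
  fixes x y :: "'a::compactly_generated_multiplicative_lattice"
  assumes "x \<le> radical y"
  shows "radical x \<le> radical y"
proof (rule le_if_compact_le)
  fix c :: 'a assume c: "compact_element c" "c \<le> radical x"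
  then obtain m where m: "m \<ge> 1" "c ^ m \<le> x" by (rule compact_le_radical)
  moreover have "compact_element (c ^ m)" using c(1) by (rule compact_power)
  ultimately obtain k where k: "k \<ge> 1" "(c ^ m) ^ k \<le> y"
    using assms order_trans by (metis compact_le_radical)
  then show "c \<le> radical y"
    using m(1) by (intro le_radical_of_power_le[of "m * k"]) (auto simp: power_mult)
qed

lemma comaximal_radical_left:
  fixes x y :: "'a::compactly_generated_multiplicative_lattice"
  assumes "comaximal (radical x) y"
  shows "comaximal x y"
proof -
  obtain c where c: "compact_element c" "c \<le> radical x" "comaximal c y"
    using assms by (rule comaximal_compact)
  then obtain k where "c ^ k \<le> x" using compact_le_radical by blast
  then show ?thesis
    using comaximal_mono[OF comaximal_power[OF c(3), of k 1], of x y] by simp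
qed

lemma comaximal_of_radical:
  fixes x y :: "'a::compactly_generated_multiplicative_lattice"
  assumes "comaximal x y" "radical x' = radical x" "radical y' = radical y"
  shows "comaximal x' y'"
proof -
  have "comaximal (radical x') (radical y')"
    using assms comaximal_mono[OF assms(1) self_le_radical self_le_radical] by simp
  then show ?thesis
    using comaximal_radical_left comaximal_commute by blast
qed

section \<open>Factorizations with prescribed radicals\<close>

text \<open>To see \<open>radical u = radical p\<close>, it suffices that each of \<open>u\<close> and
  \<open>p\<close> lies below the radical of the other. For \<open>p\<close> this uses \<open>p * q \<le> radical b\<close> and
  cancellation of the comaximal part \<open>d\<close> of \<open>q\<close>.\<close>

lemma radical_split:
  fixes p q b :: "'a::compactly_generated_multiplicative_lattice"
  assumes "comaximal p q" "radical b = radical (p * q)"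
  obtains u v where "b = u * v" "radical u = radical p" "radical v = radical q"
proof -
  obtain c where c: "compact_element c" "c \<le> p" "comaximal c q"
    using assms(1) by (rule comaximal_compact)
  then obtain d where d: "compact_element d" "d \<le> q" "comaximal d c"
    using comaximal_compact[of q c] comaximal_commute by blast
  have pq: "p * q \<le> radical b" using assms(2) self_le_radical[of "p * q"] by simp
  have "c * d \<le> radical b" using mult_mono_lattice[OF c(2) d(2)] pq by (rule order_trans)
  then obtain k where k: "k \<ge> 1" "(c * d) ^ k \<le> b"
    using compact_le_radical[OF compact_mult[OF c(1) d(1)]] by blast
  define u where "u = sup b (c ^ k)"
  define v where "v = sup b (d ^ k)"
  have bu: "b \<le> u" and bv: "b \<le> v" and cu: "c ^ k \<le> u" and dv: "d ^ k \<le> v"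
    by (auto simp: u_def v_def)
  have uv: "comaximal u v"
    using comaximal_power[OF d(3)[unfolded comaximal_commute[of d]], of k k] cu dv
    by (rule comaximal_mono)
  have "u * v \<le> b"
  proof -
    have "u * d ^ k = sup (b * d ^ k) ((c * d) ^ k)"
      by (simp add: u_def mult.commute[of _ "d ^ k"] mult_sup_distrib power_mult_distrib)
    then have "u * d ^ k \<le> b" using k by (simp add: mult_le_left)
    then show ?thesis by (simp add: v_def mult_sup_distrib mult_le_right)
  qed
  moreover have "b \<le> u * v"
  proof -
    have "b = sup (b * u) (b * v)"
      using uv by (simp add: comaximal_def flip: mult_sup_distrib)
    moreover have "b * u \<le> u * v"
      using mult_le_mono[OF bv, of u] by (simp add: mult.commute)
    moreover have "b * v \<le> u * v" using bu by (simp add: mult_mono_lattice)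
    ultimately show ?thesis by (metis le_sup_iff order_refl)
  qed
  ultimately have b: "b = u * v" by (rule order.antisym[rotated])
  have radical_b_le: "b \<le> radical p" "b \<le> radical q"
    using assms(2) self_le_radical[of b]
      radical_le_radical[OF order_trans[OF mult_le_left self_le_radical], of p q]
      radical_le_radical[OF order_trans[OF mult_le_right self_le_radical], of p q]
    by auto
  have "radical u = radical p"
  proof (rule order.antisym)
    have "c ^ k \<le> radical p"
      using power_le_self[OF k(1), of c] c(2) self_le_radical[of p] by (meson order_trans)
    then show "radical u \<le> radical p"
      using radical_b_le by (intro radical_le_radical) (simp add: u_def)
    \<comment> \<open>\<open>p * d \<le> p * q\<close> lies below \<open>radical u\<close>, which is comaximal to \<open>d\<close> as it contains \<open>c\<close>.\<close>
    have "p * d \<le> radical u"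
      using mult_le_mono[OF d(2), of p] pq radical_le_radical[OF order_trans[OF bu self_le_radical]]
      by (meson order_trans)
    moreover have "comaximal (radical u) d"
      using le_radical_of_power_le[OF k(1) cu] d(3) comaximal_commute comaximal_mono order_refl
      by metis
    ultimately show "radical p \<le> radical u"
      by (intro radical_le_radical) (rule le_of_mult_le_comaximal)
  qed
  moreover have "radical v = radical q"
  proof (rule order.antisym)
    have "d ^ k \<le> radical q"
      using power_le_self[OF k(1), of d] d(2) self_le_radical[of q] by (meson order_trans)
    then show "radical v \<le> radical q"
      using radical_b_le by (intro radical_le_radical) (simp add: v_def)
    have "q * c \<le> radical v"
      using mult_le_mono[OF c(2), of q] pq radical_le_radical[OF order_trans[OF bv self_le_radical]]
      by (metis mult.commute order_trans)
    moreover have "comaximal (radical v) c"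
      using le_radical_of_power_le[OF k(1) dv] d(3) comaximal_mono order_refl by metis
    ultimately show "radical q \<le> radical v"
      by (intro radical_le_radical) (rule le_of_mult_le_comaximal)
  qed
  ultimately show thesis using b that by blast
qed

lemma radical_prod_split:
  fixes a :: "'i \<Rightarrow> 'a::compactly_generated_multiplicative_lattice"
  assumes "finite I" "pairwise (\<lambda>i j. comaximal (a i) (a j)) I" "radical b = radical (prod a I)"
  shows "\<exists>c. b = prod c I \<and> (\<forall>i\<in>I. radical (c i) = radical (a i))"
  using assms
proof (induction I arbitrary: b rule: finite_induct)
  case empty
  \<comment> \<open>An element whose radical is \<open>1\<close> is comaximal to \<open>0\<close>, hence equals \<open>1\<close>.\<close>
  have "comaximal b bot"
    by (rule comaximal_of_radical[of 1 bot]) (use empty(2) in \<open>simp_all add: comaximal_def\<close>)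
  then show ?case by (simp add: comaximal_def)
next
  case (insert i I)
  have "comaximal (a i) (prod a I)"
    using comaximal_prod_remove[OF _ insert.prems(1), of i] insert.hyps by simp
  then obtain u v where uv: "b = u * v" "radical u = radical (a i)" "radical v = radical (prod a I)"
    using radical_split insert by (metis prod.insert)
  then obtain c where c: "v = prod c I" "\<forall>i\<in>I. radical (c i) = radical (a i)"
    using insert.IH[of v] insert.prems by (auto simp: pairwise_insert)
  have "prod (c(i := u)) I = prod c I"
    using insert.hyps by (intro prod.cong) auto
  then show ?case
    using uv c insert.hyps by (intro exI[of _ "c(i := u)"]) auto
qed

text \<open>One half of uniqueness. The factor \<open>c i\<close> is comaximal to the product of the other
  \<open>c' j\<close>, because comaximality only depends on radicals, and multiplying \<open>c' i\<close> by that
  product gives \<open>prod c I \<le> c i\<close>.\<close>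

lemma factor_le_of_prod_eq:
  fixes c c' :: "'i \<Rightarrow> 'a::compactly_generated_multiplicative_lattice"
  assumes "finite I" "pairwise (\<lambda>i j. comaximal (c i) (c j)) I"
    and "\<And>i. i \<in> I \<Longrightarrow> radical (c' i) = radical (c i)"
    and "prod c I = prod c' I" "i \<in> I"
  shows "c' i \<le> c i"
proof (rule le_of_mult_le_comaximal)
  show "comaximal (c i) (prod c' (I - {i}))"
  proof (rule comaximal_prod)
    fix j assume "j \<in> I - {i}"
    then show "comaximal (c i) (c' j)"
      by (intro comaximal_of_radical[OF pairwiseD[OF assms(2,5)]]) (use assms(3) in auto)
  qed (use assms(1) in simp)
  have "c' i * prod c' (I - {i}) = c i * prod c (I - {i})"
    using assms by (simp flip: prod.remove)
  then show "c' i * prod c' (I - {i}) \<le> c i" by (simp add: mult_le_left)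
qed

lemma radical_mult_le:
  fixes x y :: "'a::multiplicative_lattice"
  shows "radical x * y \<le> radical (x * y)"
proof -
  have "y * z \<le> radical (x * y)" if "n \<ge> 1" "z ^ n \<le> x" for n z
  proof (rule le_radical_of_power_le)
    show "(y * z) ^ n \<le> x * y"
      using mult_mono_lattice[OF power_le_self[OF that(1), of y] that(2)]
      by (simp add: power_mult_distrib mult.commute)
  qed (fact that(1))
  then have "y * radical x \<le> radical (x * y)"
    unfolding radical_def[of x] mult_Sup_distrib by (auto intro!: SUP_least)
  then show ?thesis by (simp add: mult.commute)
qed

text \<open>With \<open>d\<close> the product of the other factors, \<open>radical (a i) * d \<le> radical (prod a I) =
  prod a I \<le> a i\<close>, and \<open>d\<close> cancels.\<close>

lemma radical_factor_of_radical_prod: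
  fixes a :: "'i \<Rightarrow> 'a::multiplicative_lattice"
  assumes "finite I" "pairwise (\<lambda>i j. comaximal (a i) (a j)) I"
    and "prod a I = radical (prod a I)" "i \<in> I"
  shows "a i = radical (a i)"
proof (rule order.antisym[OF self_le_radical])
  have "radical (a i) * prod a (I - {i}) \<le> radical (prod a I)"
    using radical_mult_le[of "a i" "prod a (I - {i})"] assms by (simp flip: prod.remove)
  also have "\<dots> = a i * prod a (I - {i})" using assms by (simp flip: prod.remove)
  also have "\<dots> \<le> a i" by (rule mult_le_left)
  finally show "radical (a i) \<le> a i"
    using comaximal_prod_remove[OF assms(1,2,4)] by (rule le_of_mult_le_comaximal[rotated])
qed

theorem theorem4:
  fixes a :: "nat \<Rightarrow> 'a::compactly_generated_multiplicative_lattice" and n :: nat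
  assumes "n \<ge> 1"
    and "\<And>i. i \<in> {1..n} \<Longrightarrow> a i \<noteq> 1"
    and "pairwise (\<lambda>i j. comaximal (a i) (a j)) {1..n}"
  shows "(\<forall>b. radical b = radical (\<Prod>i=1..n. a i) \<longrightarrow>
            (\<exists>!c. c \<in> {1..n} \<rightarrow>\<^sub>E UNIV \<and>
                  b = (\<Prod>i=1..n. c i) \<and>
                  pairwise (\<lambda>i j. comaximal (c i) (c j)) {1..n} \<and>
                  (\<forall>i\<in>{1..n}. radical (c i) = radical (a i)))) \<and>
         ((\<Prod>i=1..n. a i) = radical (\<Prod>i=1..n. a i) \<longrightarrow>
            (\<forall>i\<in>{1..n}. a i = radical (a i)))"
proof (intro conjI allI impI ballI)
  fix b assume "radical b = radical (\<Prod>i=1..n. a i)"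
  then obtain c where c: "b = (\<Prod>i=1..n. c i)" "\<forall>i\<in>{1..n}. radical (c i) = radical (a i)"
    using radical_prod_split[OF _ assms(3)] by auto
  show "\<exists>!c. c \<in> {1..n} \<rightarrow>\<^sub>E UNIV \<and> b = (\<Prod>i=1..n. c i) \<and>
      pairwise (\<lambda>i j. comaximal (c i) (c j)) {1..n} \<and>
      (\<forall>i\<in>{1..n}. radical (c i) = radical (a i))"
  proof (rule ex_ex1I)
    have "pairwise (\<lambda>i j. comaximal (c i) (c j)) {1..n}"
      using assms(3) c(2) unfolding pairwise_def by (blast intro: comaximal_of_radical)
    then show "\<exists>c. c \<in> {1..n} \<rightarrow>\<^sub>E UNIV \<and> b = (\<Prod>i=1..n. c i) \<and>
        pairwise (\<lambda>i j. comaximal (c i) (c j)) {1..n} \<and>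
        (\<forall>i\<in>{1..n}. radical (c i) = radical (a i))"
      using c by (intro exI[of _ "restrict c {1..n}"]) (auto simp: pairwise_def)
  next
    fix c d
    assume c: "c \<in> {1..n} \<rightarrow>\<^sub>E UNIV \<and> b = (\<Prod>i=1..n. c i) \<and>
        pairwise (\<lambda>i j. comaximal (c i) (c j)) {1..n} \<and>
        (\<forall>i\<in>{1..n}. radical (c i) = radical (a i))"
      and d: "d \<in> {1..n} \<rightarrow>\<^sub>E UNIV \<and> b = (\<Prod>i=1..n. d i) \<and>
        pairwise (\<lambda>i j. comaximal (d i) (d j)) {1..n} \<and>
        (\<forall>i\<in>{1..n}. radical (d i) = radical (a i))"
    have "c i = d i" if "i \<in> {1..n}" for i
      using factor_le_of_prod_eq[of "{1..n}" c d i] factor_le_of_prod_eq[of "{1..n}" d c i]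
        c d that by (intro order.antisym) auto
    then show "c = d" using c d by (intro PiE_ext[of c "{1..n}" "\<lambda>_. UNIV" d]) auto
  qed
next
  fix i assume "(\<Prod>i=1..n. a i) = radical (\<Prod>i=1..n. a i)" "i \<in> {1..n}"
  then show "a i = radical (a i)"
    using radical_factor_of_radical_prod[OF _ assms(3)] by simp
qed

end
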